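(* Let $E=\mathrm{Dend}_2^1$ be the two-dimensional complex dendriform algebra with basis $\{e_1,e_2\}$ and products $e_1\prec e_1=e_1$, $e_1\succ e_2=e_2$, all other products of basis elements under $\prec$ and $\succ$ being zero. Then the Nijenhuis operators on $E$ are exactly the linear maps $P:E\to E$ whose matrix is of one of the forms $$P_1=\begin{pmatrix}a_{11}&0\\0&a_{22}\end{pmatrix},\quad P_2=\begin{pmatrix}a_{22}&a_{12}\\0&a_{22}\end{pmatrix},$$ with $a_{11},a_{12},a_{22}\in\mathbb{C}$ arbitrary.
   Context: A dendriform algebra over $\mathbb{C}$ is a complex vector space $E$ with bilinear operations $\prec,\succ$ satisfying, for all $u,v,w\in E$: $(u\prec v)\prec w=u\prec(v\prec w)+u\prec(v\succ w)$; $(u\succ v)\prec w=u\succ(v\prec w)$; $u\succ(v\succ w)=(u\prec v)\succ w+(u\succ v)\succ w$. Matrix convention: the matrix $(a_{ij})$ of a linear map $P:E\to E$ is defined by rows, $P(e_1)=a_{11}e_1+a_{12}e_2$ and $P(e_2)=a_{21}e_1+a_{22}e_2$. A Nijenhuis operator on $E$ is a linear map $P:E\to E$ such that for all $u,v\in E$: $$P(u)\prec P(v)=P\big(P(u)\prec v+u\prec P(v)-P(u\prec v)\big),$$ $$P(u)\succ P(v)=P\big(P(u)\succ v+u\succ P(v)-P(u\succ v)\big).$$ *)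

theory Defs
  imports "HOL-Analysis.Analysis"
begin

locale dendriform_algebra = vector_space smul
  for smul :: "complex \<Rightarrow> 'a::ab_group_add \<Rightarrow> 'a" (infixr \<open>\<cdot>\<close> 75) +
  fixes prec :: "'a \<Rightarrow> 'a \<Rightarrow> 'a" (infixl \<open>\<prec>\<close> 70)
    and succ :: "'a \<Rightarrow> 'a \<Rightarrow> 'a" (infixl \<open>\<succ>\<close> 70)
  assumes prec_linear_right: "Vector_Spaces.linear (\<cdot>) (\<cdot>) (\<lambda>v. u \<prec> v)"
    and prec_linear_left: "Vector_Spaces.linear (\<cdot>) (\<cdot>) (\<lambda>u. u \<prec> v)"
    and succ_linear_right: "Vector_Spaces.linear (\<cdot>) (\<cdot>) (\<lambda>v. u \<succ> v)"
    and succ_linear_left: "Vector_Spaces.linear (\<cdot>) (\<cdot>) (\<lambda>u. u \<succ> v)"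
    and prec_prec: "(u \<prec> v) \<prec> w = u \<prec> (v \<prec> w) + u \<prec> (v \<succ> w)"
    and succ_prec: "(u \<succ> v) \<prec> w = u \<succ> (v \<prec> w)"
    and succ_succ: "u \<succ> (v \<succ> w) = (u \<prec> v) \<succ> w + (u \<succ> v) \<succ> w"

definition nijenhuis_operator ::
  "(complex \<Rightarrow> 'a::ab_group_add \<Rightarrow> 'a) \<Rightarrow> ('a \<Rightarrow> 'a \<Rightarrow> 'a) \<Rightarrow> ('a \<Rightarrow> 'a \<Rightarrow> 'a) \<Rightarrow> ('a \<Rightarrow> 'a) \<Rightarrow> bool"
  where
  "nijenhuis_operator smul prec succ P \<longleftrightarrow>
     Vector_Spaces.linear smul smul P \<and>
     (\<forall>u v. prec (P u) (P v) = P (prec (P u) v + prec u (P v) - P (prec u v))) \<and>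
     (\<forall>u v. succ (P u) (P v) = P (succ (P u) v + succ u (P v) - P (succ u v)))"

text \<open>The row convention: row \<open>i\<close> of the matrix holds the coordinates of the image of the
  \<open>i\<close>-th basis vector (the transpose of the convention of the library constant \<^const>\<open>matrix\<close>).\<close>

definition has_row_matrix ::
  "(complex \<Rightarrow> 'a::ab_group_add \<Rightarrow> 'a) \<Rightarrow> 'a \<Rightarrow> 'a \<Rightarrow> ('a \<Rightarrow> 'a) \<Rightarrow> complex^2^2 \<Rightarrow> bool"
  where
  "has_row_matrix smul e1 e2 P A \<longleftrightarrow>
     P e1 = smul (A $ 1 $ 1) e1 + smul (A $ 1 $ 2) e2 \<and>
     P e2 = smul (A $ 2 $ 1) e1 + smul (A $ 2 $ 2) e2"

locale Dend_2_1 = dendriform_algebra smul prec succ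
  for smul :: "complex \<Rightarrow> 'a::ab_group_add \<Rightarrow> 'a" (infixr \<open>\<cdot>\<close> 75)
    and prec :: "'a \<Rightarrow> 'a \<Rightarrow> 'a" (infixl \<open>\<prec>\<close> 70)
    and succ :: "'a \<Rightarrow> 'a \<Rightarrow> 'a" (infixl \<open>\<succ>\<close> 70) +
  fixes e1 e2 :: 'a
  assumes basis_distinct: "e1 \<noteq> e2"
    and basis_independent: "independent {e1, e2}"
    and basis_span: "span {e1, e2} = UNIV"
    and prec_11: "e1 \<prec> e1 = e1" and prec_12: "e1 \<prec> e2 = 0"
    and prec_21: "e2 \<prec> e1 = 0" and prec_22: "e2 \<prec> e2 = 0"
    and succ_11: "e1 \<succ> e1 = 0" and succ_12: "e1 \<succ> e2 = e2"
    and succ_21: "e2 \<succ> e1 = 0" and succ_22: "e2 \<succ> e2 = 0"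

text \<open>The multiplication table does define a dendriform algebra, so the locale is inhabited.\<close>

lemma Dend_2_1_model:
  "Dend_2_1 (\<lambda>c x. (c * fst x, c * snd x)) (\<lambda>u v. (fst u * fst v, 0))
     (\<lambda>u v. (0, fst u * snd v)) (1, 0) (0, 1 :: complex)"
proof -
  let ?s = "\<lambda>(c::complex) (x::complex \<times> complex). (c * fst x, c * snd x)"
  interpret V: vector_space ?s
    by unfold_locales (auto simp: algebra_simps)
  have lin: "Vector_Spaces.linear ?s ?s f"
    if "\<And>x y. f (x + y) = f x + f y" "\<And>c x. f (?s c x) = ?s c (f x)" for f
    using that by unfold_locales auto
  have sp: "V.span {(1, 0), (0, 1)} = UNIV"
  proof -
    have "x \<in> V.span {(1, 0), (0, 1)}" for x
    proof -
      have "?s (fst x) (1, 0) + ?s (snd x) (0, 1) \<in> V.span {(1, 0), (0, 1)}"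
        by (intro V.span_add V.span_scale V.span_base) auto
      then show ?thesis by simp
    qed
    then show ?thesis by blast
  qed
  have ind: "V.independent {(1, 0), (0, 1)}"
    by (auto simp: V.independent_insert V.span_singleton zero_prod_def)
  show ?thesis
    by unfold_locales (use sp ind in \<open>auto intro!: lin simp: algebra_simps zero_prod_def\<close>)
qed

end

theory Submission
  imports Defs
begin

text \<open>In coordinates the products are \<open>(x, y) \<prec> (x', y') = (x x', 0)\<close> and
  \<open>(x, y) \<succ> (x', y') = (0, x y')\<close>. Writing \<open>P e1 = a e1 + b e2\<close> and \<open>P e2 = c e1 + d e2\<close>, the
  \<open>\<prec>\<close>-identity at \<open>(e2, e2)\<close> forces \<open>c\<^sup>2 = 0\<close>, and then the \<open>\<succ>\<close>-identity at \<open>(e1, e1)\<close> forces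
  \<open>a b = d b\<close>. Conversely, \<open>c = 0\<close> and \<open>a b = d b\<close> imply both identities for all vectors.\<close>

context Dend_2_1
begin

lemma basis_coords: "\<exists>x y. u = x \<cdot> e1 + y \<cdot> e2"
proof -
  have "u \<in> span {e1, e2}"
    by (simp add: basis_span)
  then obtain x y where "u - x \<cdot> e1 = y \<cdot> e2"
    by (auto simp: span_insert span_singleton)
  then have "u = x \<cdot> e1 + y \<cdot> e2"
    by (simp add: algebra_simps)
  then show ?thesis by blast
qed

lemma basis_coords_eq_0:
  assumes "x \<cdot> e1 + y \<cdot> e2 = 0"
  shows "x = 0 \<and> y = 0"
proof -
  \<comment> \<open>Linear independence is a statement about coefficient functions on a set. Since
    \<open>e1 \<noteq> e2\<close>, \<open>?f\<close> takes the values \<open>x\<close> and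
    \<open>y\<close>, and the sum over \<open>{e1, e2}\<close> really has two terms.\<close>
  let ?f = "\<lambda>v. if v = e1 then x else y"
  have "(\<Sum>v\<in>{e1, e2}. ?f v \<cdot> v) = 0"
    using assms basis_distinct by simp
  then have "\<forall>v\<in>{e1, e2}. ?f v = 0"
    using independentD[OF basis_independent, of "{e1, e2}" ?f] by blast
  then show ?thesis
    using basis_distinct by auto
qed

lemma basis_coords_unique:
  "x \<cdot> e1 + y \<cdot> e2 = x' \<cdot> e1 + y' \<cdot> e2 \<longleftrightarrow> x = x' \<and> y = y'"
proof
  assume "x \<cdot> e1 + y \<cdot> e2 = x' \<cdot> e1 + y' \<cdot> e2"
  then have "(x - x') \<cdot> e1 + (y - y') \<cdot> e2 = 0"
    by (simp add: scale_left_diff_distrib algebra_simps)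
  from basis_coords_eq_0[OF this] show "x = x' \<and> y = y'"
    by simp
qed simp

text \<open>The term \<open>0 \<cdot> e2\<close> is kept so that the result is again a combination
  of \<open>e1\<close> and \<open>e2\<close> to which the other coordinate rules apply.\<close>

lemma prec_coords:
  "prec (x \<cdot> e1 + y \<cdot> e2) (x' \<cdot> e1 + y' \<cdot> e2) = (x * x') \<cdot> e1 + 0 \<cdot> e2"
proof -
  interpret L: Vector_Spaces.linear smul smul "\<lambda>u. prec u v" for v
    by (rule prec_linear_left)
  interpret R: Vector_Spaces.linear smul smul "prec u" for u
    by (rule prec_linear_right)
  show ?thesis
    by (simp add: L.add L.scale R.add R.scale prec_11 prec_12 prec_21 prec_22)
qed

lemma succ_coords:
  "succ (x \<cdot> e1 + y \<cdot> e2) (x' \<cdot> e1 + y' \<cdot> e2) = 0 \<cdot> e1 + (x * y') \<cdot> e2"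
proof -
  interpret L: Vector_Spaces.linear smul smul "\<lambda>u. succ u v" for v
    by (rule succ_linear_left)
  interpret R: Vector_Spaces.linear smul smul "succ u" for u
    by (rule succ_linear_right)
  show ?thesis
    by (simp add: L.add L.scale R.add R.scale succ_11 succ_12 succ_21 succ_22)
qed

lemma add_coords:
  "(x \<cdot> e1 + y \<cdot> e2) + (x' \<cdot> e1 + y' \<cdot> e2) = (x + x') \<cdot> e1 + (y + y') \<cdot> e2"
  by (simp add: scale_left_distrib algebra_simps)

lemma diff_coords:
  "(x \<cdot> e1 + y \<cdot> e2) - (x' \<cdot> e1 + y' \<cdot> e2) = (x - x') \<cdot> e1 + (y - y') \<cdot> e2"
  by (simp add: scale_left_diff_distrib algebra_simps)

lemma linear_coords:
  assumes "Vector_Spaces.linear smul smul P"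
    and "P e1 = a \<cdot> e1 + b \<cdot> e2" and "P e2 = c \<cdot> e1 + d \<cdot> e2"
  shows "P (x \<cdot> e1 + y \<cdot> e2) = (x * a + y * c) \<cdot> e1 + (x * b + y * d) \<cdot> e2"
proof -
  interpret P: Vector_Spaces.linear smul smul P by fact
  show ?thesis
    by (simp add: P.add P.scale assms(2,3) scale_right_distrib scale_left_distrib algebra_simps)
qed

lemma nijenhuis_operator_coords_iff:
  assumes lin: "Vector_Spaces.linear smul smul P"
    and P1: "P e1 = a \<cdot> e1 + b \<cdot> e2" and P2: "P e2 = c \<cdot> e1 + d \<cdot> e2"
  shows "nijenhuis_operator smul prec succ P \<longleftrightarrow> c = 0 \<and> (b = 0 \<or> a = d)"
proof
  note coords = linear_coords[OF assms] prec_coords succ_coords add_coords diff_coords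
    basis_coords_unique
  assume "nijenhuis_operator smul prec succ P"
  then have prec: "prec (P u) (P v) = P (prec (P u) v + prec u (P v) - P (prec u v))"
    and succ: "succ (P u) (P v) = P (succ (P u) v + succ u (P v) - P (succ u v))" for u v
    unfolding nijenhuis_operator_def by blast+
  \<comment> \<open>Basis vectors are spelled with coefficients 0 and 1 so that the rules
    \<open>coords\<close> match. Here both products on the right have left and right factors one of
    which is \<open>e2\<close>, so \<open>\<prec>\<close> kills them.\<close>
  have c: "c = 0"
    using prec[of "0 \<cdot> e1 + 1 \<cdot> e2" "0 \<cdot> e1 + 1 \<cdot> e2"] unfolding coords by simp
  \<comment> \<open>On the right only \<open>e1 \<succ> P e1 = b \<cdot> e2\<close> survives, and
    \<open>P\<close> sends it to \<open>(b * d) \<cdot> e2\<close> because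
    \<open>c = 0\<close>.\<close>
  have "a * b = b * d"
    using succ[of "1 \<cdot> e1 + 0 \<cdot> e2" "1 \<cdot> e1 + 0 \<cdot> e2"] c unfolding coords by simp
  with c show "c = 0 \<and> (b = 0 \<or> a = d)"
    by (simp add: mult.commute)
next
  note coords = linear_coords[OF assms] prec_coords succ_coords add_coords diff_coords
    basis_coords_unique
  assume cd: "c = 0 \<and> (b = 0 \<or> a = d)"
  have "prec (P u) (P v) = P (prec (P u) v + prec u (P v) - P (prec u v)) \<and>
    succ (P u) (P v) = P (succ (P u) v + succ u (P v) - P (succ u v))" for u v
  proof -
    obtain x y x' y' where u: "u = x \<cdot> e1 + y \<cdot> e2" and v: "v = x' \<cdot> e1 + y' \<cdot> e2"
      using basis_coords by metis
    \<comment> \<open>With \<open>c = 0\<close>, the two sides of either identity agree in the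
      \<open>e1\<close> coordinate and differ in the \<open>e2\<close> coordinate by
      \<open>(a - d) * b * x * x'\<close> up to sign, which vanishes in both cases of
      \<open>cd\<close>.\<close>
    show ?thesis
      unfolding u v coords using cd by (auto simp: algebra_simps)
  qed
  with lin show "nijenhuis_operator smul prec succ P"
    unfolding nijenhuis_operator_def by blast
qed

lemma has_row_matrix_coords_iff:
  assumes "P e1 = a \<cdot> e1 + b \<cdot> e2" and "P e2 = c \<cdot> e1 + d \<cdot> e2"
  shows "has_row_matrix smul e1 e2 P (vector [vector [a', b'], vector [c', d']]) \<longleftrightarrow>
    a = a' \<and> b = b' \<and> c = c' \<and> d = d'"
  by (auto simp: has_row_matrix_def assms basis_coords_unique vector_2)

end

theorem theorem2p4:
  fixes smul :: "complex \<Rightarrow> 'a::ab_group_add \<Rightarrow> 'a"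
    and prec succ :: "'a \<Rightarrow> 'a \<Rightarrow> 'a"
    and e1 e2 :: 'a
  assumes "Dend_2_1 smul prec succ e1 e2"
  shows "{P. nijenhuis_operator smul prec succ P} =
    {P. Vector_Spaces.linear smul smul P \<and>
        (\<exists>a11 a12 a22.
           has_row_matrix smul e1 e2 P (vector [vector [a11, 0], vector [0, a22]]) \<or>
           has_row_matrix smul e1 e2 P (vector [vector [a22, a12], vector [0, a22]]))}"
proof -
  interpret Dend_2_1 smul prec succ e1 e2 by fact
  have "nijenhuis_operator smul prec succ P \<longleftrightarrow>
    (\<exists>a11 a12 a22.
       has_row_matrix smul e1 e2 P (vector [vector [a11, 0], vector [0, a22]]) \<or>
       has_row_matrix smul e1 e2 P (vector [vector [a22, a12], vector [0, a22]]))"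
    if lin: "Vector_Spaces.linear smul smul P" for P
  proof -
    obtain a b c d where P: "P e1 = smul a e1 + smul b e2" "P e2 = smul c e1 + smul d e2"
      using basis_coords by metis
    \<comment> \<open>The case \<open>b = 0\<close> is the diagonal form with
      \<open>a11 = a\<close>, and \<open>a = d\<close> is the triangular form with
      \<open>a12 = b\<close>; \<open>a22 = d\<close> in both.\<close>
    show ?thesis
      unfolding nijenhuis_operator_coords_iff[OF lin P] has_row_matrix_coords_iff[of P, OF P]
      by auto
  qed
  moreover have "Vector_Spaces.linear smul smul P" if "nijenhuis_operator smul prec succ P" for P
    using that unfolding nijenhuis_operator_def by blast
  ultimately show ?thesis
    by blast
qed

end
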